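(* Let $N,d\ge1$, $\Lambda\in(\mathbb R_+^\ast)^N$, $L\in V_+(\Lambda)$, $A=(A_1,\dots,A_N):\mathbb R\to\mathcal M_d(\mathbb C)^N$, and $u_0:[-L_{\max},0)\to\mathbb C^d$. The corresponding solution $u:[-L_{\max},+\infty)\to\mathbb C^d$ of $\Sigma_\delta(L,A)$ with initial condition $u_0$ is given for $t\ge0$ by $$u(t)=\sum_{\substack{[\mathbf n]\in\mathcal Z\\ t<L\cdot\mathbf n\le t+L_{\max}}}\Theta^{L,\Lambda,A}_{[\mathbf n],t}\,u_0(t-L\cdot\mathbf n).$$
   Context: $\mathbb N=\{0,1,2,\dots\}$, $\mathbb R_+^\ast=(0,+\infty)$; $\mathcal M_d(\mathbb C)$ is the set of complex $d\times d$ matrices; $e_1,\dots,e_N$ is the canonical basis of $\mathbb Z^N$; $L_{\max}$ is the largest component of $L$. $\Sigma_\delta(L,A)$ is the difference equation $u(t)=\sum_{j=1}^NA_j(t)u(t-L_j)$, $t\ge0$; its solution with initial condition $u_0$ is the unique $u:[-L_{\max},+\infty)\to\mathbb C^d$ satisfying it for all $t\ge0$ and $u=u_0$ on $[-L_{\max},0)$. $Z(\Lambda)=\{\mathbf n\in\mathbb Z^N:\Lambda\cdot\mathbf n=0\}$; $V_+(\Lambda)=\{L\in(\mathbb R_+^\ast)^N:Z(\Lambda)\subset Z(L)\}$. Matrices $\Xi^{L,A}_{\mathbf n,t}\in\mathcal M_d(\mathbb C)$ ($\mathbf n\in\mathbb Z^N$, $t\in\mathbb R$) are defined inductively by $\Xi^{L,A}_{\mathbf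 n,t}=0$ if $\mathbf n\in\mathbb Z^N\setminus\mathbb N^N$, $\Xi^{L,A}_{0,t}=\mathrm{Id}_d$, and $\Xi^{L,A}_{\mathbf n,t}=\sum_{k=1}^NA_k(t)\,\Xi^{L,A}_{\mathbf n-e_k,t-L_k}$ if $\mathbf n\in\mathbb N^N\setminus\{0\}$. On $\{1,\dots,N\}$ let $i\sim j$ iff $\Lambda_i=\Lambda_j$; on $\mathbb Z^N$ let $\mathbf n\approx\mathbf n'$ iff $\Lambda\cdot\mathbf n=\Lambda\cdot\mathbf n'$. $[\cdot]$ denotes equivalence classes, $\mathcal J=\{1,\dots,N\}/\sim$, $\mathcal Z=\mathbb Z^N/\approx$. For $L\in V_+(\Lambda)$, $L_j$ depends only on $[j]$ and $L\cdot\mathbf n$ only on $[\mathbf n]$. Define $\widehat\Xi^{L,\Lambda,A}_{[\mathbf n],t}=\sum_{\mathbf n'\in[\mathbf n]}\Xi^{L,A}_{\mathbf n',t}$ (a sum with finitely many nonzero terms), $\widehat A^\Lambda_{[i]}(t)=\sum_{j\in[i]}A_j(t)$, and $$\Theta^{L,\Lambda,A}_{[\mathbf n],t}=\sum_{\substack{[j]\in\mathcal J\\ L\cdot\mathbf n-L_j\le t}}\widehat\Xi^{L,\Lambda,A}_{[\mathbf n-e_j],t}\,\widehat A^\Lambda_{[j]}(t-L\cdot\mathbf n+L_j).$$ $\Theta^{L,\Lambda,A}_{[\mathbf n],t}$ vanishes unless $[\mathbf n]\cap(\mathbb N^N\setminus\{0\})\neq\emptyset$, so the sum over $[\mathbf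 n]$ has finitely many nonzero terms. *)

theory Defs
  imports "HOL-Analysis.Analysis"
begin

text \<open>
  Conventions: the index set \<open>{1..N}\<close> is a finite type \<open>'n\<close>, \<open>\<complex>\<^sup>d\<close> is \<open>complex^'d\<close>, and
  \<open>\<int>\<^sup>N\<close> is \<open>int^'n\<close>, whose canonical basis is \<open>axis k 1\<close>. Sums with an infinite index set but only
  finitely many nonzero terms are written with the library operator \<open>sum'\<close>.
\<close>

definition ldot :: "real^'n \<Rightarrow> int^'n \<Rightarrow> real"
  where "ldot L n = (\<Sum>i\<in>UNIV. L $ i * of_int (n $ i))"

definition L_max :: "real^'n \<Rightarrow> real"
  where "L_max L = Max (range (($) L))"

definition Z_rel :: "real^'n \<Rightarrow> (int^'n) set"
  where "Z_rel \<Lambda> = {n. ldot \<Lambda> n = 0}"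

definition V_plus :: "real^'n \<Rightarrow> (real^'n) set"
  where "V_plus \<Lambda> = {L. (\<forall>i. 0 < L $ i) \<and> Z_rel \<Lambda> \<subseteq> Z_rel L}"

definition is_solution ::
  "real^'n \<Rightarrow> (real \<Rightarrow> (complex^'d^'d)^'n) \<Rightarrow> (real \<Rightarrow> complex^'d) \<Rightarrow> (real \<Rightarrow> complex^'d) \<Rightarrow> bool"
  where "is_solution L A u\<^sub>0 u \<longleftrightarrow>
    (\<forall>t\<in>{- L_max L..<0}. u t = u\<^sub>0 t) \<and>
    (\<forall>t\<ge>0. u t = (\<Sum>j\<in>UNIV. A t $ j *v u (t - L $ j)))"

function Xi :: "real^'n \<Rightarrow> (real \<Rightarrow> (complex^'d^'d)^'n) \<Rightarrow> int^'n \<Rightarrow> real \<Rightarrow> complex^'d^'d"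
  where "Xi L A n t =
    (if \<exists>i. n $ i < 0 then 0
     else if n = 0 then mat 1
     else (\<Sum>k\<in>UNIV. A t $ k ** Xi L A (n - axis k 1) (t - L $ k)))"
  by auto
termination
proof (relation "Wellfounded.measure (\<lambda>(L, A, n, t). nat (\<Sum>i\<in>UNIV. n $ i))")
  fix L :: "real^'n" and A :: "real \<Rightarrow> (complex^'d^'d)^'n" and n :: "int^'n" and t :: real and k :: 'n
  assume nn: "\<not> (\<exists>i. n $ i < 0)" and "n \<noteq> 0"
  then obtain i where "n $ i > 0"
    by (metis linorder_neqE_linordered_idom vec_eq_iff zero_index)
  then have pos: "(\<Sum>i\<in>UNIV. n $ i) > 0"
    using nn by (intro sum_pos2[of _ i]) (auto simp: not_less)
  have "(\<Sum>i\<in>UNIV. (n - axis k 1) $ i) = (\<Sum>i\<in>UNIV. n $ i) - 1"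
    by (simp add: sum_subtractf axis_def)
  with pos show "((L, A, n - axis k 1, t - L $ k), (L, A, n, t))
      \<in> Wellfounded.measure (\<lambda>(L, A, n, t). nat (\<Sum>i\<in>UNIV. n $ i))"
    by simp
qed simp

declare Xi.simps [simp del]

definition delay_rel :: "real^'n \<Rightarrow> ('n \<times> 'n) set"
  where "delay_rel \<Lambda> = {(i, j). \<Lambda> $ i = \<Lambda> $ j}"

definition lattice_rel :: "real^'n \<Rightarrow> ((int^'n) \<times> (int^'n)) set"
  where "lattice_rel \<Lambda> = {(n, n'). ldot \<Lambda> n = ldot \<Lambda> n'}"

definition delay_classes :: "real^'n \<Rightarrow> 'n set set"
  where "delay_classes \<Lambda> = UNIV // delay_rel \<Lambda>"

definition lattice_classes :: "real^'n \<Rightarrow> (int^'n) set set"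
  where "lattice_classes \<Lambda> = UNIV // lattice_rel \<Lambda>"

text \<open>The common value on a class of a function that is constant on that class.\<close>

definition on_class :: "('a \<Rightarrow> 'b) \<Rightarrow> 'a set \<Rightarrow> 'b"
  where "on_class f C = the_elem (f ` C)"

text \<open>For classes \<open>C = [n]\<close> and \<open>c = [j]\<close> this is the class \<open>[n - e\<^sub>j]\<close>.\<close>

definition class_shift :: "real^'n \<Rightarrow> (int^'n) set \<Rightarrow> 'n set \<Rightarrow> (int^'n) set"
  where "class_shift \<Lambda> C c = on_class (\<lambda>(n, j). lattice_rel \<Lambda> `` {n - axis j 1}) (C \<times> c)"

definition Xi_hat ::
  "real^'n \<Rightarrow> (real \<Rightarrow> (complex^'d^'d)^'n) \<Rightarrow> (int^'n) set \<Rightarrow> real \<Rightarrow> complex^'d^'d"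
  where "Xi_hat L A C t = sum' (\<lambda>n. Xi L A n t) C"

definition A_hat :: "(real \<Rightarrow> (complex^'d^'d)^'n) \<Rightarrow> 'n set \<Rightarrow> real \<Rightarrow> complex^'d^'d"
  where "A_hat A c t = (\<Sum>j\<in>c. A t $ j)"

text \<open>\<open>Xi_hat\<close> and \<open>A_hat\<close> depend on \<open>\<Lambda>\<close> only through the classes they are applied to.\<close>

definition Theta ::
  "real^'n \<Rightarrow> real^'n \<Rightarrow> (real \<Rightarrow> (complex^'d^'d)^'n) \<Rightarrow> (int^'n) set \<Rightarrow> real \<Rightarrow> complex^'d^'d"
  where "Theta L \<Lambda> A C t =
    (\<Sum>c | c \<in> delay_classes \<Lambda> \<and> on_class (ldot L) C - on_class (($) L) c \<le> t.
       Xi_hat L A (class_shift \<Lambda> C c) t ** A_hat A c (t - on_class (ldot L) C + on_class (($) L) c))"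


subsection \<open>Well-definedness\<close>

lemma on_class_eq: "x \<in> C \<Longrightarrow> (\<And>y. y \<in> C \<Longrightarrow> f y = f x) \<Longrightarrow> on_class f C = f x"
  unfolding on_class_def by (metis the_elem_image_unique empty_iff)

lemma ldot_diff: "ldot L (m - n) = ldot L m - ldot L n"
  by (simp add: ldot_def algebra_simps sum_subtractf)

lemma ldot_axis [simp]: "ldot L (axis j 1) = L $ j"
proof -
  have "L $ i * of_int (axis j 1 $ i) = (if i = j then L $ i else 0)" for i
    by (simp add: axis_def)
  then show ?thesis by (simp add: ldot_def)
qed

lemma equiv_delay_rel: "equiv UNIV (delay_rel \<Lambda>)"
  by (auto simp: equiv_def delay_rel_def refl_on_def sym_def trans_def)

lemma equiv_lattice_rel: "equiv UNIV (lattice_rel \<Lambda>)"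
  by (auto simp: equiv_def lattice_rel_def refl_on_def sym_def trans_def)

lemma V_plus_ldot:
  assumes "L \<in> V_plus \<Lambda>" "ldot \<Lambda> m = ldot \<Lambda> n"
  shows "ldot L m = ldot L n"
proof -
  have "m - n \<in> Z_rel \<Lambda>"
    using assms(2) by (simp add: Z_rel_def ldot_diff)
  then have "m - n \<in> Z_rel L"
    using assms(1) by (auto simp: V_plus_def)
  then show ?thesis by (simp add: Z_rel_def ldot_diff)
qed

lemma V_plus_nth:
  assumes "L \<in> V_plus \<Lambda>" "\<Lambda> $ i = \<Lambda> $ j"
  shows "L $ i = L $ j"
  using V_plus_ldot[OF assms(1), of "axis i 1" "axis j 1"] assms(2) by simp

lemma on_class_ldot:
  "L \<in> V_plus \<Lambda> \<Longrightarrow> on_class (ldot L) (lattice_rel \<Lambda> `` {n}) = ldot L n"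
  by (rule on_class_eq) (auto simp: lattice_rel_def dest: V_plus_ldot)

lemma on_class_nth:
  "L \<in> V_plus \<Lambda> \<Longrightarrow> on_class (($) L) (delay_rel \<Lambda> `` {j}) = L $ j"
  by (rule on_class_eq) (auto simp: delay_rel_def dest: V_plus_nth)

lemma class_shift_eq:
  "class_shift \<Lambda> (lattice_rel \<Lambda> `` {n}) (delay_rel \<Lambda> `` {j}) = lattice_rel \<Lambda> `` {n - axis j 1}"
proof -
  let ?f = "\<lambda>(n, j). lattice_rel \<Lambda> `` {n - axis j 1}"
  have "on_class ?f (lattice_rel \<Lambda> `` {n} \<times> delay_rel \<Lambda> `` {j}) = ?f (n, j)"
  proof (rule on_class_eq)
    fix y
    assume "y \<in> lattice_rel \<Lambda> `` {n} \<times> delay_rel \<Lambda> `` {j}"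
    then show "?f y = ?f (n, j)"
      by (cases y) (simp add: lattice_rel_def delay_rel_def ldot_diff Image_def)
  qed (simp add: lattice_rel_def delay_rel_def)
  then show ?thesis by (simp add: class_shift_def)
qed

lemma finite_nonneg_ldot_le:
  fixes L :: "real^'n"
  assumes "\<And>i. 0 < L $ i"
  shows "finite {n. (\<forall>i. 0 \<le> n $ i) \<and> ldot L n \<le> r}"
proof -
  have "n $ i \<le> \<lceil>r / L $ i\<rceil>" if nn: "\<forall>i. 0 \<le> n $ i" and le: "ldot L n \<le> r" for n :: "int^'n" and i
  proof -
    have "L $ i * of_int (n $ i) \<le> ldot L n"
      unfolding ldot_def using nn assms by (intro member_le_sum) (auto simp: less_imp_le)
    then have "of_int (n $ i) \<le> r / L $ i"
      using le assms[of i] by (simp add: field_simps)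
    then show ?thesis by linarith
  qed
  then have "vec_nth ` {n. (\<forall>i. 0 \<le> n $ i) \<and> ldot L n \<le> r} \<subseteq> Pi UNIV (\<lambda>i. {0..\<lceil>r / L $ i\<rceil>})"
    by auto
  moreover have "finite (Pi UNIV (\<lambda>i::'n. {0..\<lceil>r / L $ i\<rceil>}))"
    using finite_PiE[of UNIV "\<lambda>i::'n. {0..\<lceil>r / L $ i\<rceil>}"] by (simp add: PiE_UNIV_domain)
  ultimately show ?thesis
    by (meson finite_imageD finite_subset inj_onI vec_nth_inject)
qed

lemma Xi_nonneg: "Xi L A n t \<noteq> 0 \<Longrightarrow> 0 \<le> n $ i"
  by (subst (asm) Xi.simps) (auto split: if_splits simp: not_less)

lemma finite_Xi_support:
  assumes "\<And>i. 0 < \<Lambda> $ i" "C \<in> lattice_classes \<Lambda>"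
  shows "finite {n \<in> C. Xi L A n t \<noteq> 0}"
proof -
  obtain m where "C = lattice_rel \<Lambda> `` {m}"
    using assms(2) by (auto simp: lattice_classes_def quotient_def)
  then have "{n \<in> C. Xi L A n t \<noteq> 0} \<subseteq> {n. (\<forall>i. 0 \<le> n $ i) \<and> ldot \<Lambda> n \<le> ldot \<Lambda> m}"
    by (auto simp: lattice_rel_def dest: Xi_nonneg)
  then show ?thesis
    using finite_nonneg_ldot_le[OF assms(1)] finite_subset by blast
qed

lemma Theta_nonzero:
  assumes "C \<in> lattice_classes \<Lambda>" "Theta L \<Lambda> A C t \<noteq> 0"
  obtains n where "n \<in> C" "\<forall>i. 0 \<le> n $ i" "n \<noteq> 0"
proof -
  obtain m where m: "C = lattice_rel \<Lambda> `` {m}"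
    using assms(1) by (auto simp: lattice_classes_def quotient_def)
  obtain c where c: "c \<in> delay_classes \<Lambda>" "Xi_hat L A (class_shift \<Lambda> C c) t \<noteq> 0"
  proof (rule ccontr)
    assume "\<not> thesis"
    then have "Xi_hat L A (class_shift \<Lambda> C c) t = 0" if "c \<in> delay_classes \<Lambda>" for c
      using \<open>\<And>c. c \<in> delay_classes \<Lambda> \<Longrightarrow> Xi_hat L A (class_shift \<Lambda> C c) t \<noteq> 0 \<Longrightarrow> thesis\<close>[OF that]
      by argo
    then have "Theta L \<Lambda> A C t = 0"
      unfolding Theta_def by (intro sum.neutral) (simp add: matrix_matrix_mult_def vec_eq_iff)
    with assms(2) show False ..
  qed
  obtain j where j: "c = delay_rel \<Lambda> `` {j}"
    using c(1) by (auto simp: delay_classes_def quotient_def)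
  obtain k where k: "k \<in> lattice_rel \<Lambda> `` {m - axis j 1}" "Xi L A k t \<noteq> 0"
    using c(2) unfolding Xi_hat_def m j class_shift_eq sum.G_def
    by (metis (no_types, lifting) sum.neutral mem_Collect_eq)
  have nn: "0 \<le> k $ i" for i using k(2) by (rule Xi_nonneg)
  have ld: "ldot \<Lambda> (k + axis j 1) = ldot \<Lambda> m"
    using k(1) ldot_diff[of \<Lambda> "k + axis j 1" "axis j 1"] by (simp add: lattice_rel_def ldot_diff)
  have "k + axis j 1 \<in> C" using ld by (simp add: m lattice_rel_def)
  moreover have "\<forall>i. 0 \<le> (k + axis j 1) $ i" using nn by (auto simp: axis_def)
  moreover have "(k + axis j 1) $ j \<noteq> 0" using nn[of j] by (simp add: axis_def)
  then have "k + axis j 1 \<noteq> 0" by fastforce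
  ultimately show thesis by (rule that)
qed

lemma finite_Theta_support:
  assumes L: "L \<in> V_plus \<Lambda>"
  shows "finite {C \<in> lattice_classes \<Lambda>. on_class (ldot L) C \<le> r \<and> Theta L \<Lambda> A C t \<noteq> 0}"
proof -
  let ?S = "{n. (\<forall>i. 0 \<le> n $ i) \<and> ldot L n \<le> r}"
  have "finite ?S"
    using L by (intro finite_nonneg_ldot_le) (simp add: V_plus_def)
  then have fin: "finite ((\<lambda>n. lattice_rel \<Lambda> `` {n}) ` ?S)"
    by (rule finite_imageI)
  have sub: "C \<in> (\<lambda>n. lattice_rel \<Lambda> `` {n}) ` ?S"
    if C: "C \<in> lattice_classes \<Lambda>" "on_class (ldot L) C \<le> r" "Theta L \<Lambda> A C t \<noteq> 0" for C
  proof -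
    obtain n where n: "n \<in> C" "\<forall>i. 0 \<le> n $ i"
      using Theta_nonzero[OF C(1,3)] by blast
    have "C = lattice_rel \<Lambda> `` {n}"
      using C(1) n(1) equiv_lattice_rel[of \<Lambda>] unfolding lattice_classes_def
      by (metis Image_singleton_iff equiv_class_eq quotientE)
    then show ?thesis using n C(2) on_class_ldot[OF L] by auto
  qed
  show ?thesis
    by (rule finite_subset[OF _ fin], rule subsetI, rule sub) simp_all
qed

text \<open>
  Existence and uniqueness of the solution, by recursion on the number of steps of length at most
  the smallest delay.
\<close>

function sol :: "real^'n \<Rightarrow> (real \<Rightarrow> (complex^'d^'d)^'n) \<Rightarrow> (real \<Rightarrow> complex^'d) \<Rightarrow> real \<Rightarrow> complex^'d"
  where "sol L A u\<^sub>0 t =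
    (if t < 0 \<or> (\<exists>j. L $ j \<le> 0) then u\<^sub>0 t
     else (\<Sum>j\<in>UNIV. A t $ j *v sol L A u\<^sub>0 (t - L $ j)))"
  by auto

lemma delay_step_less:
  fixes L :: "real^'n"
  assumes "0 \<le> t" "\<And>j. 0 < L $ j"
  shows "nat \<lceil>(t - L $ k) / Min (range (($) L)) + 1\<rceil> < nat \<lceil>t / Min (range (($) L)) + 1\<rceil>"
proof -
  define m where "m = Min (range (($) L))"
  have "m \<in> range (($) L)" unfolding m_def by (rule Min_in) auto
  then have m: "0 < m" using assms(2) by auto
  have "m \<le> L $ k" by (simp add: m_def)
  then have "(t - L $ k) / m \<le> t / m - 1" using m by (simp add: field_simps)
  moreover have "0 \<le> t / m" using m assms(1) by simp
  ultimately show ?thesis unfolding m_def[symmetric] by linarith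
qed

termination sol
proof (relation "Wellfounded.measure (\<lambda>(L, A, u\<^sub>0, t). nat \<lceil>t / Min (range (($) L)) + 1\<rceil>)")
  fix L :: "real^'n" and A :: "real \<Rightarrow> (complex^'d^'d)^'n" and u\<^sub>0 :: "real \<Rightarrow> complex^'d"
    and t :: real and k :: 'n
  assume "\<not> (t < 0 \<or> (\<exists>j. L $ j \<le> 0))"
  then have "0 \<le> t" "\<And>j. 0 < L $ j" by (auto simp: not_le not_less)
  from delay_step_less[OF this] show "((L, A, u\<^sub>0, t - L $ k), (L, A, u\<^sub>0, t))
      \<in> Wellfounded.measure (\<lambda>(L, A, u\<^sub>0, t). nat \<lceil>t / Min (range (($) L)) + 1\<rceil>)"
    by simp
qed simp

declare sol.simps [simp del]

lemma is_solution_sol: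
  assumes "\<And>j. 0 < L $ j"
  shows "is_solution L A u\<^sub>0 (sol L A u\<^sub>0)"
  unfolding is_solution_def
proof (intro conjI ballI allI impI)
  fix t :: real
  assume "t \<in> {- L_max L..<0}"
  then show "sol L A u\<^sub>0 t = u\<^sub>0 t" by (subst sol.simps) simp
next
  fix t :: real
  assume "0 \<le> t"
  moreover have "\<not> (\<exists>j. L $ j \<le> 0)" using assms by (simp add: not_le)
  ultimately show "sol L A u\<^sub>0 t = (\<Sum>j\<in>UNIV. A t $ j *v sol L A u\<^sub>0 (t - L $ j))"
    by (subst sol.simps) simp
qed

lemma is_solution_unique:
  assumes "\<And>j. 0 < L $ j" "is_solution L A u\<^sub>0 u" "is_solution L A u\<^sub>0 v" "- L_max L \<le> t"
  shows "u t = v t"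
  using assms(4)
proof (induction "nat \<lceil>t / Min (range (($) L)) + 1\<rceil>" arbitrary: t rule: less_induct)
  case less
  show ?case
  proof (cases "t < 0")
    case True
    then show ?thesis using less.prems assms(2,3) by (simp add: is_solution_def)
  next
    case False
    have "u (t - L $ j) = v (t - L $ j)" for j
    proof (rule less.hyps)
      show "nat \<lceil>(t - L $ j) / Min (range (($) L)) + 1\<rceil> < nat \<lceil>t / Min (range (($) L)) + 1\<rceil>"
        using delay_step_less[OF _ assms(1)] False by simp
      have "L $ j \<le> L_max L" by (simp add: L_max_def)
      then show "- L_max L \<le> t - L $ j" using False by simp
    qed
    then show ?thesis using False assms(2,3) by (simp add: is_solution_def)
  qed
qed

end

theory Submission
  imports Defs
begin

text \<open>
  The initial condition acts as a source term: for \<open>t \<ge> 0\<close> the equation reads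
  \<open>u(t) = g(t) + \<Sum>\<^sub>k A\<^sub>k(t) u(t - L\<^sub>k)\<close>, where \<open>g\<close> collects the terms that involve \<open>u\<^sub>0\<close> and the sum runs
  over the \<open>k\<close> with \<open>L\<^sub>k \<le> t\<close>. Iterating gives the Duhamel formula
  \<open>u(t) = \<Sum>\<^sub>m \<Xi>\<^sub>m\<^sub>,\<^sub>t g(t - L\<cdot>m)\<close> over the \<open>m \<in> \<nat>\<^sup>N\<close> with \<open>L\<cdot>m \<le> t\<close>. Expanding \<open>g\<close> turns this into
  a sum over pairs \<open>(m, j)\<close> with \<open>L\<cdot>m \<le> t < L\<cdot>m + L\<^sub>j\<close>. Grouping the pairs by the class \<open>[m + e\<^sub>j]\<close>, and
  inside each group by \<open>[j]\<close>, produces \<open>\<Theta>\<close>.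
\<close>

lemma ldot_add: "ldot L (m + n) = ldot L m + ldot L n"
  using ldot_diff[of L "m + n" n] by simp

lemma ldot_zero [simp]: "ldot L 0 = 0"
  by (simp add: ldot_def)

lemma sum_matrix_vector_mult:
  fixes M :: "'a \<Rightarrow> 'b::semiring_1^'m^'k"
  shows "(\<Sum>i\<in>I. M i) *v x = (\<Sum>i\<in>I. M i *v x)"
  by (induction I rule: infinite_finite_induct) (simp_all add: matrix_vector_mult_add_rdistrib)

lemma matrix_vector_mult_sum:
  fixes M :: "'b::semiring_1^'m^'k"
  shows "M *v (\<Sum>i\<in>I. x i) = (\<Sum>i\<in>I. M *v x i)"
  by (induction I rule: infinite_finite_induct) (simp_all add: matrix_vector_right_distrib)

text \<open>\<open>sum'\<close> defaults to 0 on infinite support, so a finite set containing the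
  support is what secures the intended value.\<close>

lemma sum'_eq_sum_of_support:
  assumes "finite T" "T \<subseteq> I" "\<And>x. x \<in> I \<Longrightarrow> x \<notin> T \<Longrightarrow> f x = 0"
  shows "sum' f I = sum f T"
proof -
  have "sum' f I = sum' f T"
    using assms(2,3) by (intro sum.mono_neutral_right') auto
  then show ?thesis by (simp add: sum.eq_sum assms(1))
qed

section \<open>The Duhamel formula\<close>

definition lattice_points :: "real^'n \<Rightarrow> real \<Rightarrow> (int^'n) set"
  where "lattice_points L t = {m. (\<forall>i. 0 \<le> m $ i) \<and> ldot L m \<le> t}"

lemma finite_lattice_points: "(\<And>i. 0 < L $ i) \<Longrightarrow> finite (lattice_points L t)"
  unfolding lattice_points_def by (rule finite_nonneg_ldot_le)

lemma ldot_nonneg: "(\<And>i. 0 < L $ i) \<Longrightarrow> (\<And>i. 0 \<le> m $ i) \<Longrightarrow> 0 \<le> ldot L m"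
  unfolding ldot_def by (intro sum_nonneg) (simp add: less_imp_le)

lemma lattice_points_negative: "(\<And>i. 0 < L $ i) \<Longrightarrow> t < 0 \<Longrightarrow> lattice_points L t = {}"
  using ldot_nonneg[of L] by (force simp: lattice_points_def)

text \<open>The inequality is strict because at \<open>s = L $ j\<close> the delayed time is 0,
  where the equation, not \<open>u\<^sub>0\<close>, determines the solution.\<close>

definition source ::
  "real^'n \<Rightarrow> (real \<Rightarrow> (complex^'d^'d)^'n) \<Rightarrow> (real \<Rightarrow> complex^'d) \<Rightarrow> real \<Rightarrow> complex^'d"
  where "source L A u\<^sub>0 s = (\<Sum>j | s < L $ j. A s $ j *v u\<^sub>0 (s - L $ j))"

definition duhamel ::
  "real^'n \<Rightarrow> (real \<Rightarrow> (complex^'d^'d)^'n) \<Rightarrow> (real \<Rightarrow> complex^'d) \<Rightarrow> real \<Rightarrow> complex^'d"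
  where "duhamel L A g t = (\<Sum>m\<in>lattice_points L t. Xi L A m t *v g (t - ldot L m))"

lemma Xi_zero: "Xi L A 0 t = mat 1"
  by (subst Xi.simps) simp

lemma Xi_step:
  assumes "\<And>i. 0 \<le> n $ i" "n \<noteq> 0"
  shows "Xi L A n t = (\<Sum>k\<in>UNIV. A t $ k ** Xi L A (n - axis k 1) (t - L $ k))"
proof -
  have "\<not> (\<exists>i. n $ i < 0)" using assms(1) by (simp add: not_less)
  then show ?thesis using assms(2) by (subst Xi.simps) simp
qed

text \<open>Reindex by \<open>m + axis k 1\<close>. The points missed by this shift have zero
  \<open>k\<close>-th coordinate, and there \<open>Xi\<close> vanishes because its index leaves the
  nonnegative orthant.\<close>

lemma duhamel_shift:
  assumes pos: "\<And>i. 0 < L $ i"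
  shows "(\<Sum>m\<in>lattice_points L t - {0}. Xi L A (m - axis k 1) (t - L $ k) *v g (t - ldot L m))
    = duhamel L A g (t - L $ k)"
proof -
  let ?T = "(\<lambda>m. m + axis k 1) ` lattice_points L (t - L $ k)"
  have sub: "?T \<subseteq> lattice_points L t - {0}"
  proof
    fix n assume "n \<in> ?T"
    then obtain m where m: "m \<in> lattice_points L (t - L $ k)" "n = m + axis k 1" by blast
    have nn: "0 \<le> m $ i" for i using m(1) by (simp add: lattice_points_def)
    have "n $ k \<noteq> 0" using nn[of k] m(2) by (simp add: axis_def)
    then have "n \<noteq> 0" by fastforce
    moreover have "\<forall>i. 0 \<le> n $ i" using nn m(2) by (simp add: axis_def)
    ultimately show "n \<in> lattice_points L t - {0}"
      using m by (simp add: lattice_points_def ldot_add)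
  qed
  have zero: "Xi L A (n - axis k 1) (t - L $ k) = 0"
    if n: "n \<in> lattice_points L t - {0} - ?T" for n
  proof (rule ccontr)
    assume "Xi L A (n - axis k 1) (t - L $ k) \<noteq> 0"
    then have "\<forall>i. 0 \<le> (n - axis k 1) $ i" using Xi_nonneg by blast
    then have "n - axis k 1 \<in> lattice_points L (t - L $ k)"
      using n by (simp add: lattice_points_def ldot_diff)
    then have "n - axis k 1 + axis k 1 \<in> ?T" by (rule imageI)
    then show False using n by simp
  qed
  have "(\<Sum>m\<in>lattice_points L t - {0}. Xi L A (m - axis k 1) (t - L $ k) *v g (t - ldot L m))
    = (\<Sum>m\<in>?T. Xi L A (m - axis k 1) (t - L $ k) *v g (t - ldot L m))"
    by (rule sum.mono_neutral_right) (use sub zero finite_lattice_points[OF pos] in auto)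
  also have "\<dots> = duhamel L A g (t - L $ k)"
    unfolding duhamel_def
    by (subst sum.reindex) (auto simp: inj_on_def ldot_add algebra_simps)
  finally show ?thesis .
qed

text \<open>The index 0 contributes \<open>g t\<close>; for the other indices the recursion of
  \<open>Xi\<close> pulls out the factor \<open>A t $ k\<close>, and exchanging the two sums leaves
  shifted Duhamel sums.\<close>

lemma duhamel_step:
  assumes pos: "\<And>i. 0 < L $ i" and "0 \<le> t"
  shows "duhamel L A g t = g t + (\<Sum>k\<in>UNIV. A t $ k *v duhamel L A g (t - L $ k))"
proof -
  have "0 \<in> lattice_points L t"
    using \<open>0 \<le> t\<close> by (simp add: lattice_points_def)
  then have "duhamel L A g t
      = g t + (\<Sum>m\<in>lattice_points L t - {0}. Xi L A m t *v g (t - ldot L m))"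
    unfolding duhamel_def
    by (subst sum.remove[OF finite_lattice_points[OF pos]]) (auto simp: Xi_zero)
  also have "(\<Sum>m\<in>lattice_points L t - {0}. Xi L A m t *v g (t - ldot L m))
      = (\<Sum>m\<in>lattice_points L t - {0}. \<Sum>k\<in>UNIV.
          A t $ k *v (Xi L A (m - axis k 1) (t - L $ k) *v g (t - ldot L m)))"
  proof (rule sum.cong[OF refl])
    fix m assume "m \<in> lattice_points L t - {0}"
    then have "Xi L A m t = (\<Sum>k\<in>UNIV. A t $ k ** Xi L A (m - axis k 1) (t - L $ k))"
      by (intro Xi_step) (auto simp: lattice_points_def)
    then show "Xi L A m t *v g (t - ldot L m)
      = (\<Sum>k\<in>UNIV. A t $ k *v (Xi L A (m - axis k 1) (t - L $ k) *v g (t - ldot L m)))"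
      by (simp add: sum_matrix_vector_mult matrix_vector_mul_assoc)
  qed
  also have "\<dots> = (\<Sum>k\<in>UNIV. A t $ k *v duhamel L A g (t - L $ k))"
    by (subst sum.swap) (simp add: matrix_vector_mult_sum[symmetric] duhamel_shift[OF pos])
  finally show ?thesis .
qed

text \<open>Extended by \<open>u\<^sub>0\<close> to negative times, the Duhamel sum solves the same
  initial value problem, so uniqueness applies.\<close>

lemma solution_eq_duhamel:
  assumes pos: "\<And>i. 0 < L $ i" and sol: "is_solution L A u\<^sub>0 u" and "0 \<le> t"
  shows "u t = duhamel L A (source L A u\<^sub>0) t"
proof -
  let ?v = "\<lambda>t. if t < 0 then u\<^sub>0 t else duhamel L A (source L A u\<^sub>0) t"
  have "is_solution L A u\<^sub>0 ?v"
    unfolding is_solution_def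
  proof (intro conjI ballI allI impI)
    fix t :: real assume t: "0 \<le> t"
    \<comment> \<open>At negative delayed times only the source contributes, at the others only the
      Duhamel sum; the two sums thus merge into one over all \<open>j\<close>.\<close>
    have neg: "duhamel L A (source L A u\<^sub>0) s = 0" if "s < 0" for s
      using that by (simp add: duhamel_def lattice_points_negative[OF pos])
    have "source L A u\<^sub>0 t = (\<Sum>j\<in>UNIV. if t < L $ j then A t $ j *v u\<^sub>0 (t - L $ j) else 0)"
      unfolding source_def by (simp add: sum.If_cases)
    then show "?v t = (\<Sum>j\<in>UNIV. A t $ j *v ?v (t - L $ j))"
      using t by (simp add: duhamel_step[OF pos] sum.distrib[symmetric])
        (intro sum.cong, auto simp: neg)
  qed simp
  \<comment> \<open>Uniqueness is stated for times from \<open>- L_max L\<close> on; this puts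
    \<open>t\<close> in that range.\<close>
  moreover have "0 \<le> L_max L"
  proof -
    have "L $ undefined \<le> L_max L" by (simp add: L_max_def)
    then show ?thesis using pos[of undefined] by linarith
  qed
  ultimately show ?thesis
    using is_solution_unique[OF pos sol, of ?v t] \<open>0 \<le> t\<close> by simp
qed

section \<open>Crossing pairs and their grouping by classes\<close>

lemma Xi_hat_eq_sum:
  assumes pos: "\<And>i. 0 < L $ i" and le: "\<And>n. n \<in> D \<Longrightarrow> ldot L n \<le> t"
  shows "Xi_hat L A D t = (\<Sum>m\<in>D \<inter> lattice_points L t. Xi L A m t)"
  unfolding Xi_hat_def
proof (rule sum'_eq_sum_of_support)
  show "finite (D \<inter> lattice_points L t)"
    using finite_lattice_points[OF pos] by blast
  \<comment> \<open>By \<open>le\<close>, a point of \<open>D\<close> outside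
    \<open>lattice_points L t\<close> must have a negative coordinate.\<close>
  show "Xi L A n t = 0" if "n \<in> D" "n \<notin> D \<inter> lattice_points L t" for n
    using that le Xi_nonneg[of L A n t] by (auto simp: lattice_points_def)
qed simp

text \<open>These are the unit steps of a lattice path that carry \<open>ldot L\<close> from at most
  \<open>t\<close> to strictly above \<open>t\<close>.\<close>

definition crossing_pairs :: "real^'n \<Rightarrow> real \<Rightarrow> ((int^'n) \<times> 'n) set"
  where "crossing_pairs L t = {(m, j). m \<in> lattice_points L t \<and> t < ldot L m + L $ j}"

lemma finite_crossing_pairs: "(\<And>i. 0 < L $ i) \<Longrightarrow> finite (crossing_pairs L t)"
  by (rule finite_subset[of _ "lattice_points L t \<times> UNIV"])
    (auto simp: crossing_pairs_def finite_lattice_points)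

lemma solution_eq_sum_crossing_pairs:
  assumes pos: "\<And>i. 0 < L $ i" and sol: "is_solution L A u\<^sub>0 u" and "0 \<le> t"
  shows "u t = (\<Sum>(m, j)\<in>crossing_pairs L t.
    Xi L A m t *v (A (t - ldot L m) $ j *v u\<^sub>0 (t - ldot L m - L $ j)))"
proof -
  have S: "crossing_pairs L t
      = Sigma (lattice_points L t) (\<lambda>m. {j. t - ldot L m < L $ j})"
    by (auto simp: crossing_pairs_def)
  show ?thesis
    unfolding solution_eq_duhamel[OF assms] duhamel_def source_def S matrix_vector_mult_sum
    by (rule sum.Sigma) (auto simp: finite_lattice_points[OF pos])
qed

text \<open>Sort the crossing pairs that land in \<open>C\<close> by the class of \<open>j\<close>.
  Each group is a full product of lattice points and delay indices, so its sum factors into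
  \<open>Xi_hat\<close> times \<open>A_hat\<close>, one summand of \<open>Theta\<close>.\<close>

lemma Theta_mult_eq_sum_crossing_pairs:
  fixes A :: "real \<Rightarrow> (complex^'d^'d)^'n" and f :: "real \<Rightarrow> complex^'d"
  assumes L: "L \<in> V_plus \<Lambda>" and t: "t < ldot L n"
  defines "C \<equiv> lattice_rel \<Lambda> `` {n}"
  shows "Theta L \<Lambda> A C t *v f (t - ldot L n)
    = (\<Sum>(m, j) | (m, j) \<in> crossing_pairs L t \<and> lattice_rel \<Lambda> `` {m + axis j 1} = C.
        Xi L A m t *v (A (t - ldot L m) $ j *v f (t - ldot L m - L $ j)))"
proof -
  have pos: "0 < L $ i" for i using L by (simp add: V_plus_def)
  let ?F = "\<lambda>(m, j). Xi L A m t *v (A (t - ldot L m) $ j *v f (t - ldot L m - L $ j))"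
  let ?S = "{x \<in> crossing_pairs L t. lattice_rel \<Lambda> `` {fst x + axis (snd x) 1} = C}"
  let ?cl = "\<lambda>x. delay_rel \<Lambda> `` {snd x}"
  let ?B = "{c. c \<in> delay_classes \<Lambda> \<and> on_class (ldot L) C - on_class (($) L) c \<le> t}"
  let ?G = "\<lambda>c. Xi_hat L A (class_shift \<Lambda> C c) t
    ** A_hat A c (t - on_class (ldot L) C + on_class (($) L) c)"
  have LC: "on_class (ldot L) C = ldot L n"
    unfolding C_def by (rule on_class_ldot[OF L])
  have mem: "lattice_rel \<Lambda> `` {m} = C \<longleftrightarrow> ldot \<Lambda> m = ldot \<Lambda> n" for m
    unfolding C_def using eq_equiv_class_iff[OF equiv_lattice_rel, of m n \<Lambda>]
    by (simp add: lattice_rel_def)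
  have pair: "ldot L m = ldot L n - L $ j \<and> m \<in> lattice_points L t"
    if "(m, j) \<in> ?S" for m j
    using that V_plus_ldot[OF L, of "m + axis j 1" n] by (auto simp: mem ldot_add crossing_pairs_def)
  have fiber: "?G c *v f (t - ldot L n) = sum ?F {x \<in> ?S. ?cl x = c}" if c: "c \<in> ?B" for c
  proof -
    obtain j0 where j0: "c = delay_rel \<Lambda> `` {j0}"
      using c by (auto simp: delay_classes_def quotient_def)
    have Lc: "on_class (($) L) c = L $ j0"
      unfolding j0 by (rule on_class_nth[OF L])
    have Lj: "L $ j = L $ j0" if "j \<in> c" for j
      using that V_plus_nth[OF L, of j j0] by (simp add: j0 delay_rel_def)
    define D where "D = lattice_rel \<Lambda> `` {n - axis j0 1}"
    have D: "m \<in> D \<longleftrightarrow> ldot \<Lambda> m = ldot \<Lambda> n - \<Lambda> $ j0" for m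
      by (auto simp: D_def lattice_rel_def ldot_diff)
    have LD: "ldot L m = ldot L n - L $ j0" if "m \<in> D" for m
      using that V_plus_ldot[OF L, of m "n - axis j0 1"] by (simp add: D ldot_diff)
    have cl: "delay_rel \<Lambda> `` {j} = c \<longleftrightarrow> j \<in> c" for j
      unfolding j0 using eq_equiv_class_iff[OF equiv_delay_rel, of j j0 \<Lambda>]
      by (auto simp: delay_rel_def)
    \<comment> \<open>The summation constraint in \<open>Theta\<close> says exactly that
      \<open>D\<close> lies at or below level \<open>t\<close>.\<close>
    have le: "ldot L n - L $ j0 \<le> t" using c by (simp add: LC Lc)
    \<comment> \<open>The crossing inequality couples \<open>m\<close> and \<open>j\<close> only in
      appearance: on this product \<open>ldot L m + L $ j\<close> equals \<open>ldot L n\<close>,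
      which exceeds \<open>t\<close>.\<close>
    have S: "{x \<in> ?S. ?cl x = c} = (D \<inter> lattice_points L t) \<times> c"
    proof (intro set_eqI iffI)
      fix x assume x: "x \<in> {x \<in> ?S. ?cl x = c}"
      obtain m j where mj: "x = (m, j)" by (cases x)
      have "j \<in> c" using x mj cl by simp
      then have "\<Lambda> $ j = \<Lambda> $ j0" by (simp add: j0 delay_rel_def)
      then show "x \<in> (D \<inter> lattice_points L t) \<times> c"
        using x mj \<open>j \<in> c\<close> by (auto simp: mem ldot_add D crossing_pairs_def)
    next
      fix x assume x: "x \<in> (D \<inter> lattice_points L t) \<times> c"
      obtain m j where mj: "x = (m, j)" by (cases x)
      then have "j \<in> c" "m \<in> D" "m \<in> lattice_points L t" using x by auto
      moreover have "\<Lambda> $ j = \<Lambda> $ j0" using \<open>j \<in> c\<close> by (simp add: j0 delay_rel_def)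
      ultimately show "x \<in> {x \<in> ?S. ?cl x = c}"
        using t by (simp add: mj cl mem ldot_add D[symmetric] crossing_pairs_def LD Lj)
          (simp add: D)
    qed
    have "sum ?F {x \<in> ?S. ?cl x = c} = (\<Sum>m\<in>D \<inter> lattice_points L t. \<Sum>j\<in>c. ?F (m, j))"
      unfolding S by (simp add: sum.cartesian_product)
    also have "\<dots> = (\<Sum>m\<in>D \<inter> lattice_points L t. \<Sum>j\<in>c.
        Xi L A m t *v (A (t - ldot L n + L $ j0) $ j *v f (t - ldot L n)))"
      by (intro sum.cong refl) (simp add: LD Lj algebra_simps)
    also have "\<dots> = (\<Sum>m\<in>D \<inter> lattice_points L t. Xi L A m t)
        *v (A_hat A c (t - ldot L n + L $ j0) *v f (t - ldot L n))"
      unfolding A_hat_def sum_matrix_vector_mult matrix_vector_mult_sum by (rule sum.swap)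
    also have "(\<Sum>m\<in>D \<inter> lattice_points L t. Xi L A m t) = Xi_hat L A (class_shift \<Lambda> C c) t"
      unfolding C_def j0 class_shift_eq D_def[symmetric]
      by (rule Xi_hat_eq_sum[OF pos, symmetric]) (simp add: LD le)
    finally show ?thesis by (simp add: LC Lc matrix_vector_mul_assoc)
  qed
  \<comment> \<open>The constraint in \<open>Theta\<close> discards no crossing pair, since
    \<open>ldot L n - L $ j\<close> is \<open>ldot L m\<close>, at most \<open>t\<close>.\<close>
  have "?cl ` ?S \<subseteq> ?B"
  proof (rule image_subsetI)
    fix x assume x: "x \<in> ?S"
    obtain m j where mj: "x = (m, j)" by (cases x)
    have "ldot L n - L $ j \<le> t" using pair[of m j] x mj by (simp add: lattice_points_def)
    then show "?cl x \<in> ?B"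
      by (simp add: mj LC on_class_nth[OF L] delay_classes_def quotientI)
  qed
  then have "sum ?F ?S = (\<Sum>c\<in>?B. sum ?F {x \<in> ?S. ?cl x = c})"
    using finite_crossing_pairs[OF pos] by (intro sum.group[symmetric]) auto
  also have "\<dots> = Theta L \<Lambda> A C t *v f (t - ldot L n)"
    unfolding Theta_def sum_matrix_vector_mult by (rule sum.cong[OF refl]) (rule fiber[symmetric])
  finally show ?thesis
    by (simp add: case_prod_unfold)
qed

theorem proposition3p14:
  fixes \<Lambda> L :: "real^'n"
    and A :: "real \<Rightarrow> (complex^'d^'d)^'n"
    and u\<^sub>0 u :: "real \<Rightarrow> complex^'d"
    and t :: real
  assumes "\<And>i. 0 < \<Lambda> $ i"
    and "L \<in> V_plus \<Lambda>"
    and "is_solution L A u\<^sub>0 u"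
    and "0 \<le> t"
  shows "u t =
    sum' (\<lambda>C. Theta L \<Lambda> A C t *v u\<^sub>0 (t - on_class (ldot L) C))
      {C \<in> lattice_classes \<Lambda>. t < on_class (ldot L) C \<and> on_class (ldot L) C \<le> t + L_max L}"
proof -
  have pos: "0 < L $ i" for i using assms(2) by (simp add: V_plus_def)
  let ?F = "\<lambda>(m, j). Xi L A m t *v (A (t - ldot L m) $ j *v u\<^sub>0 (t - ldot L m - L $ j))"
  let ?cl = "\<lambda>(m, j). lattice_rel \<Lambda> `` {m + axis j 1}"
  let ?S = "crossing_pairs L t"
  let ?I = "{C \<in> lattice_classes \<Lambda>. t < on_class (ldot L) C \<and> on_class (ldot L) C \<le> t + L_max L}"
  let ?H = "\<lambda>C. Theta L \<Lambda> A C t *v u\<^sub>0 (t - on_class (ldot L) C)"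
  have fin: "finite ?S" by (rule finite_crossing_pairs[OF pos])
  have fiber: "?H C = sum ?F {x \<in> ?S. ?cl x = C}" if C: "C \<in> ?I" for C
  proof -
    obtain n where n: "C = lattice_rel \<Lambda> `` {n}"
      using C by (auto simp: lattice_classes_def quotient_def)
    have LC: "on_class (ldot L) C = ldot L n"
      unfolding n by (rule on_class_ldot[OF assms(2)])
    then have "t < ldot L n" using C by simp
    from Theta_mult_eq_sum_crossing_pairs[OF assms(2) this, of A u\<^sub>0] show ?thesis
      unfolding LC by (simp add: n case_prod_unfold)
  qed
  \<comment> \<open>The window for the classes: a crossing step ends strictly above \<open>t\<close>
    and rises by at most \<open>L_max L\<close>.\<close>
  have sub: "?cl ` ?S \<subseteq> ?I"
  proof clarify
    fix m j assume "(m, j) \<in> ?S"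
    moreover have "L $ j \<le> L_max L" by (simp add: L_max_def)
    ultimately show "lattice_rel \<Lambda> `` {m + axis j 1} \<in> lattice_classes \<Lambda>
      \<and> t < on_class (ldot L) (lattice_rel \<Lambda> `` {m + axis j 1})
      \<and> on_class (ldot L) (lattice_rel \<Lambda> `` {m + axis j 1}) \<le> t + L_max L"
      by (auto simp: on_class_ldot[OF assms(2)] ldot_add lattice_classes_def quotientI
          crossing_pairs_def lattice_points_def)
  qed
  have "u t = sum ?F ?S"
    by (rule solution_eq_sum_crossing_pairs[OF pos assms(3,4)])
  also have "\<dots> = (\<Sum>C\<in>?cl ` ?S. sum ?F {x \<in> ?S. ?cl x = C})"
    by (rule sum.image_gen[OF fin])
  also have "\<dots> = sum ?H (?cl ` ?S)"
    by (rule sum.cong[OF refl]) (use fiber sub in force)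
  also have "\<dots> = sum' ?H ?I"
  \<comment> \<open>\<open>?I\<close> may be infinite, but a class in which no crossing pair ends
    has an empty fiber, hence a zero term.\<close>
  proof (rule sum'_eq_sum_of_support[symmetric])
    fix C assume C: "C \<in> ?I" "C \<notin> ?cl ` ?S"
    then have "{x \<in> ?S. ?cl x = C} = {}" by blast
    then show "?H C = 0" unfolding fiber[OF C(1)] by (simp only: sum.empty)
  qed (use fin sub in auto)
  finally show ?thesis .
qed

end
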